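(* Consider the problem $\min_{x\in\mathcal X} f(x)$, $f=\frac1n\sum_{i=1}^n f_i$, where $\mathcal X\subset\mathbb R^d$ is nonempty, convex and compact with $\|x-y\|\le D$ for all $x,y\in\mathcal X$; $f$ is $L$-smooth on $\mathcal X$; each $f_i$ is $L_i$-smooth on $\mathcal X$; and $f$ is convex on $\mathcal X$ (the individual $f_i$ need not be convex). Let $\tilde L^2=\frac1n\sum_{i=1}^n L_i^2$ and let $x^*$ be a minimizer of $f$ on $\mathcal X$. Let $\{x^k\}$ be the iterates of the Sarah Frank-Wolfe algorithm (described in the context) with probability $p\in(0,1]$ and batch size $b$. For any integer $K\ge 1$, choose the step sizes, for $0\le k\le K-1$, as $$\eta_k=\begin{cases}\dfrac p2, & \text{if } K\le \dfrac2p,\\[2mm] \dfrac p2, & \text{if } K>\dfrac 2p \text{ and } k<\lceil K/2\rceil,\\[2mm] \dfrac{2}{4/p+k-\lceil K/2\rceil}, & \text{if } K>\dfrac2p\text{ and } k\ge\lceil K/2\rceil.\end{cases}$$ Then $$\mathbb E\left[f(x^K)-f(x^* )\right]=\mathcal O\left(\frac{f(x^0)-f(x^* )}{p}\exp\left(-\frac{Kp}{4}\right)+\left[1+\frac{\tilde L}{L}\sqrt{\frac{1-p}{pb}}\right]\frac{LD^2}{K}\right),$$ where $\mathcal O(\cdot)$ hides an absolute numerical constant.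
   Context: Norms and inner products are Euclidean and $[n]=\{1,\dots,n\}$. The $f_i$ are real-valued and differentiable on $\mathcal X$ (say, on an open neighbourhood of $\mathcal X$). A function $h$ is $M$-smooth on $\mathcal X$ ($M>0$) if $\|\nabla h(x)-\nabla h(y)\|\le M\|x-y\|$ for all $x,y\in\mathcal X$. Convexity of $f$ on $\mathcal X$ means $f(x)\ge f(y)+\langle\nabla f(y),x-y\rangle$ for all $x,y\in\mathcal X$. The constants satisfy $L,L_i,D>0$. Sarah Frank-Wolfe algorithm. Parameters: step sizes $\{\eta_k\}$, probability $p$, integer batch size $b$ with $1\le b\le n$. Initialization: $x^0\in\mathcal X$ (deterministic), $g^0=\nabla f(x^0)$. For $k=0,1,\dots,K-1$: (1) $s^k\in\arg\min_{s\in\mathcal X}\langle g^k,s\rangle$ (any minimizer, chosen as a measurable function of the past); (2) $x^{k+1}=x^k+\eta_k(s^k-x^k)$; (3) draw a batch $S_k$ of $b$ indices uniformly at random from $[n]$ (i.i.d., with repetitions counted in sums over $S_k$), independent of the past; (4) with probability $p$ (independently of everything else) set $g^{k+1}=\nabla f(x^{k+1})$; otherwise, with probability $1-p$, set $g^{k+1}=g^k+\frac1b\sum_{i\in S_k}[\nabla f_i(x^{k+1})-\nabla f_i(x^k)]$. The statement "$A=\mathcal O(B)$" means $A\le C\,B$ for an absolute constant $C$ independent of the problem instance, $n,d,p,b,K$ and $x^0$. *)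

theory Defs
  imports "HOL-Probability.Probability"
begin

text \<open>
  The hidden constant of the convergence bound must not depend on the dimension, so the dimension
  \<open>d\<close> has to be quantified inside the statement and cannot be a type. Points of \<open>\<real>\<^sup>d\<close> are therefore
  elements of \<open>topspace (Euclidean_space d)\<close>, i.e. real sequences that vanish from index \<open>d\<close> on.
  (The class-level \<open>dist\<close> on \<open>nat \<Rightarrow> real\<close> is not the Euclidean distance and is not used.)
\<close>

type_synonym rvec = "nat \<Rightarrow> real"

definition inner_Rd :: "nat \<Rightarrow> rvec \<Rightarrow> rvec \<Rightarrow> real" where
  "inner_Rd d x y = (\<Sum>j<d. x j * y j)"

definition norm_Rd :: "nat \<Rightarrow> rvec \<Rightarrow> real" where
  "norm_Rd d x = L2_set x {..<d}"

definition convex_Rd :: "rvec set \<Rightarrow> bool" where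
  "convex_Rd X \<longleftrightarrow>
     (\<forall>x\<in>X. \<forall>y\<in>X. \<forall>t\<in>{0..1::real}. (\<lambda>j. (1 - t) * x j + t * y j) \<in> X)"

text \<open>Frechet differentiability of \<open>h\<close> at \<open>x\<close>, the derivative being represented by the vector \<open>v\<close>.\<close>

definition has_gradient :: "nat \<Rightarrow> (rvec \<Rightarrow> real) \<Rightarrow> rvec \<Rightarrow> rvec \<Rightarrow> bool" where
  "has_gradient d h x v \<longleftrightarrow> v \<in> topspace (Euclidean_space d) \<and>
     (\<forall>\<epsilon>>0. \<exists>\<delta>>0. \<forall>y\<in>topspace (Euclidean_space d). norm_Rd d (\<lambda>j. y j - x j) < \<delta> \<longrightarrow>
        \<bar>h y - h x - inner_Rd d v (\<lambda>j. y j - x j)\<bar> \<le> \<epsilon> * norm_Rd d (\<lambda>j. y j - x j))"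

definition grad :: "nat \<Rightarrow> (rvec \<Rightarrow> real) \<Rightarrow> rvec \<Rightarrow> rvec" where
  "grad d h x = (THE v. has_gradient d h x v)"

definition differentiable_near :: "nat \<Rightarrow> (rvec \<Rightarrow> real) \<Rightarrow> rvec set \<Rightarrow> bool" where
  "differentiable_near d h X \<longleftrightarrow>
     (\<exists>U. openin (Euclidean_space d) U \<and> X \<subseteq> U \<and> (\<forall>x\<in>U. \<exists>v. has_gradient d h x v))"

definition smooth_on_Rd :: "nat \<Rightarrow> real \<Rightarrow> (rvec \<Rightarrow> real) \<Rightarrow> rvec set \<Rightarrow> bool" where
  "smooth_on_Rd d M h X \<longleftrightarrow>
     (\<forall>x\<in>X. \<forall>y\<in>X. norm_Rd d (\<lambda>j. grad d h x j - grad d h y j) \<le> M * norm_Rd d (\<lambda>j. x j - y j))"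

definition grad_convex_on :: "nat \<Rightarrow> (rvec \<Rightarrow> real) \<Rightarrow> rvec set \<Rightarrow> bool" where
  "grad_convex_on d h X \<longleftrightarrow>
     (\<forall>x\<in>X. \<forall>y\<in>X. h x \<ge> h y + inner_Rd d (grad d h y) (\<lambda>j. x j - y j))"

definition avg_fun :: "nat \<Rightarrow> (nat \<Rightarrow> rvec \<Rightarrow> real) \<Rightarrow> rvec \<Rightarrow> real" where
  "avg_fun n fs x = (\<Sum>i=1..n. fs i x) / real n"

text \<open>
  The randomness of one iteration: a batch of \<open>b\<close> independent uniform indices from \<open>{1..n}\<close> (a list,
  so repetitions count) and, independently, a coin that is \<open>True\<close> with probability \<open>p\<close>. A run of
  length \<open>K\<close> uses \<open>K\<close> independent copies, in chronological order.
\<close>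

type_synonym draw = "nat list \<times> bool"

definition draw_pmf :: "nat \<Rightarrow> nat \<Rightarrow> real \<Rightarrow> draw pmf" where
  "draw_pmf n b p = pair_pmf (replicate_pmf b (pmf_of_set {1..n})) (bernoulli_pmf p)"

definition draws_pmf :: "nat \<Rightarrow> nat \<Rightarrow> real \<Rightarrow> nat \<Rightarrow> draw list pmf" where
  "draws_pmf n b p K = replicate_pmf K (draw_pmf n b p)"

text \<open>
  \<open>sarah_fw \<dots> \<omega> k\<close> is the pair \<open>(x\<^sup>k, g\<^sup>k)\<close> for the draws \<open>\<omega>\<close>. The vector \<open>s\<^sup>k\<close> is \<open>sel (take k \<omega>)\<close>, a function
  of the draws made before iteration \<open>k\<close>; as the starting point is deterministic, these determine
  the whole past, and as the draws are discrete, every such function is measurable.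
\<close>

primrec sarah_fw ::
  "nat \<Rightarrow> nat \<Rightarrow> (nat \<Rightarrow> rvec \<Rightarrow> real) \<Rightarrow> nat \<Rightarrow> (nat \<Rightarrow> real) \<Rightarrow> (draw list \<Rightarrow> rvec) \<Rightarrow> rvec
     \<Rightarrow> draw list \<Rightarrow> nat \<Rightarrow> rvec \<times> rvec" where
  "sarah_fw d n fs b \<eta> sel x0 \<omega> 0 = (x0, grad d (avg_fun n fs) x0)"
| "sarah_fw d n fs b \<eta> sel x0 \<omega> (Suc k) =
     (let (x, g) = sarah_fw d n fs b \<eta> sel x0 \<omega> k;
          s = sel (take k \<omega>);
          x' = (\<lambda>j. x j + \<eta> k * (s j - x j));
          (batch, coin) = \<omega> ! k;
          g' = (if coin then grad d (avg_fun n fs) x'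
                else (\<lambda>j. g j + (\<Sum>i\<leftarrow>batch. grad d (fs i) x' j - grad d (fs i) x j) / real b))
      in (x', g'))"

text \<open>The selection rule solves the linear subproblem in every run of positive probability.\<close>

definition lmo_rule ::
  "nat \<Rightarrow> rvec set \<Rightarrow> nat \<Rightarrow> (nat \<Rightarrow> rvec \<Rightarrow> real) \<Rightarrow> nat \<Rightarrow> real \<Rightarrow> (nat \<Rightarrow> real) \<Rightarrow> rvec \<Rightarrow> nat
     \<Rightarrow> (draw list \<Rightarrow> rvec) \<Rightarrow> bool" where
  "lmo_rule d X n fs b p \<eta> x0 K sel \<longleftrightarrow>
     (\<forall>\<omega>\<in>set_pmf (draws_pmf n b p K). \<forall>k<K.
        is_arg_min (inner_Rd d (snd (sarah_fw d n fs b \<eta> sel x0 \<omega> k))) (\<lambda>s. s \<in> X)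
          (sel (take k \<omega>)))"

definition fw_step :: "real \<Rightarrow> nat \<Rightarrow> nat \<Rightarrow> real" where
  "fw_step p K k =
     (if real K \<le> 2 / p then p / 2
      else if int k < \<lceil>real K / 2\<rceil> then p / 2
      else 2 / (4 / p + real k - of_int \<lceil>real K / 2\<rceil>))"

end

theory Submission
  imports Defs
begin

text \<open>
  The proof is a potential argument. Smoothness and convexity give the usual Frank-Wolfe inequality
  with an additional term, step size times diameter times the norm of the error of the gradient
  estimate \<open>g\<close> (\<open>frank_wolfe_descent\<close>). The expected squared error contracts by the factor \<open>1 - p\<close>,
  since with probability \<open>p\<close> it is reset to zero, up to an increment proportional to the squared step
  size, since the mini-batch correction is unbiased and its variance is controlled by the smoothness
  of the components (\<open>estimate_error_contraction\<close>).

  For step sizes \<open>\<eta> \<le> p / 2\<close> the expected value \<open>\<Phi>\<close> of the optimality gap plus a suitable multiple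
  of the squared error therefore satisfies
  \<open>\<Phi> (k + 1) \<le> (1 - \<eta> k) * \<Phi> k + (\<eta> k)\<^sup>2 * (3 / 2 * A * D\<^sup>2)\<close>, where the effective smoothness \<open>A\<close> is
  \<open>L\<close> times the bracket of the convergence bound (\<open>potential_step\<close>, \<open>expected_potential_recursion\<close>).
  Initially the error vanishes, so \<open>\<Phi> 0\<close> is the initial optimality gap. What remains is the
  analysis of this scalar recursion for the given step sizes (\<open>fw_step_recursion\<close>).
\<close>

section \<open>Euclidean vectors as sequences\<close>

lemma norm_Rd_power2: "(norm_Rd d x)\<^sup>2 = (\<Sum>j<d. (x j)\<^sup>2)"
  by (simp add: norm_Rd_def L2_set_def sum_nonneg)

lemma norm_Rd_nonneg: "0 \<le> norm_Rd d x"
  by (simp add: norm_Rd_def)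

lemma norm_Rd_scale: "norm_Rd d (\<lambda>j. c * x j) = \<bar>c\<bar> * norm_Rd d x"
proof -
  have "(norm_Rd d (\<lambda>j. c * x j))\<^sup>2 = (\<bar>c\<bar> * norm_Rd d x)\<^sup>2"
    by (simp add: norm_Rd_power2 power_mult_distrib sum_distrib_left)
  then show ?thesis
    by (simp add: norm_Rd_nonneg)
qed

lemma inner_Rd_Cauchy_Schwarz: "\<bar>inner_Rd d x y\<bar> \<le> norm_Rd d x * norm_Rd d y"
proof -
  have "\<bar>inner_Rd d x y\<bar> \<le> (\<Sum>j<d. \<bar>x j\<bar> * \<bar>y j\<bar>)"
    unfolding inner_Rd_def by (rule order_trans[OF sum_abs]) (simp add: abs_mult)
  also have "\<dots> \<le> norm_Rd d x * norm_Rd d y"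
    unfolding norm_Rd_def by (rule L2_set_mult_ineq)
  finally show ?thesis .
qed

lemma inner_Rd_scale_right: "inner_Rd d v (\<lambda>j. c * x j) = c * inner_Rd d v x"
  by (simp add: inner_Rd_def sum_distrib_left mult_ac)

lemma inner_Rd_diff_right: "inner_Rd d v (\<lambda>j. x j - y j) = inner_Rd d v x - inner_Rd d v y"
  by (simp add: inner_Rd_def sum_subtractf algebra_simps)

lemma inner_Rd_diff_left: "inner_Rd d (\<lambda>j. v j - w j) x = inner_Rd d v x - inner_Rd d w x"
  by (simp add: inner_Rd_def sum_subtractf algebra_simps)

section \<open>Gradients\<close>

lemma has_gradient_DERIV_line:
  assumes "has_gradient d h (\<lambda>j. x j + t * u j) v"
    and x: "x \<in> topspace (Euclidean_space d)" and u: "u \<in> topspace (Euclidean_space d)"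
  shows "((\<lambda>t. h (\<lambda>j. x j + t * u j)) has_real_derivative inner_Rd d v u) (at t)"
  unfolding has_field_derivative_def has_derivative_at_alt
proof (intro conjI allI impI)
  show "bounded_linear ((*) (inner_Rd d v u))"
    by (rule bounded_linear_mult_right)
  fix e :: real assume e: "e > 0"
  define N where "N = norm_Rd d u + 1"
  have N: "N > 0" "norm_Rd d u \<le> N"
    using norm_Rd_nonneg[of d u] by (auto simp: N_def)
  obtain \<delta> where \<delta>: "\<delta> > 0" and
    lin: "\<And>y. y \<in> topspace (Euclidean_space d) \<Longrightarrow> norm_Rd d (\<lambda>j. y j - (x j + t * u j)) < \<delta> \<Longrightarrow>
      \<bar>h y - h (\<lambda>j. x j + t * u j) - inner_Rd d v (\<lambda>j. y j - (x j + t * u j))\<bar>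
        \<le> e / N * norm_Rd d (\<lambda>j. y j - (x j + t * u j))"
    using assms(1) e N unfolding has_gradient_def by (meson divide_pos_pos)
  show "\<exists>r>0. \<forall>s. norm (s - t) < r \<longrightarrow>
      norm (h (\<lambda>j. x j + s * u j) - h (\<lambda>j. x j + t * u j) - inner_Rd d v u * (s - t))
        \<le> e * norm (s - t)"
  proof (intro exI[of _ "\<delta> / N"] conjI allI impI)
    show "\<delta> / N > 0" using \<delta> N by simp
    fix s assume s: "norm (s - t) < \<delta> / N"
    have eq: "(\<lambda>j. x j + s * u j - (x j + t * u j)) = (\<lambda>j. (s - t) * u j)"
      by (auto simp: algebra_simps)
    have le: "\<bar>s - t\<bar> * norm_Rd d u \<le> \<bar>s - t\<bar> * N"
      using N by (intro mult_left_mono) auto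
    have lt: "\<bar>s - t\<bar> * norm_Rd d u < \<delta>"
      using le s N by (simp add: field_simps)
    have "(\<lambda>j. x j + s * u j) \<in> topspace (Euclidean_space d)"
      using x u by (simp add: topspace_Euclidean_space)
    from lin[OF this, unfolded eq norm_Rd_scale inner_Rd_scale_right] lt
    have "\<bar>h (\<lambda>j. x j + s * u j) - h (\<lambda>j. x j + t * u j) - (s - t) * inner_Rd d v u\<bar>
        \<le> e / N * (\<bar>s - t\<bar> * norm_Rd d u)"
      by blast
    also have "\<dots> \<le> e / N * (\<bar>s - t\<bar> * N)"
      using le e N by (intro mult_left_mono) auto
    also have "\<dots> = e * \<bar>s - t\<bar>"
      using N by simp
    finally show "norm (h (\<lambda>j. x j + s * u j) - h (\<lambda>j. x j + t * u j) - inner_Rd d v u * (s - t))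
        \<le> e * norm (s - t)"
      by (simp add: mult.commute)
  qed
qed

lemma has_gradient_unique:
  assumes v: "has_gradient d h x v" and w: "has_gradient d h x w"
    and x: "x \<in> topspace (Euclidean_space d)"
  shows "v = w"
proof
  fix j
  show "v j = w j"
  proof (cases "j < d")
    case True
    \<comment> \<open>Both sides are the partial derivative in the direction of the basis vector \<open>u\<close>.\<close>
    define u :: rvec where "u = (\<lambda>i. if i = j then 1 else 0)"
    have u: "u \<in> topspace (Euclidean_space d)"
      using True by (auto simp: u_def topspace_Euclidean_space)
    have coord: "inner_Rd d z u = z j" for z
      using True by (simp add: inner_Rd_def u_def if_distrib cong: if_cong)
    have "has_gradient d h (\<lambda>j. x j + 0 * u j) v" "has_gradient d h (\<lambda>j. x j + 0 * u j) w"
      using v w by simp_all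
    then have "inner_Rd d v u = inner_Rd d w u"
      by (blast intro: DERIV_unique has_gradient_DERIV_line x u)
    then show ?thesis by (simp add: coord)
  next
    case False
    then show ?thesis
      using v w by (simp add: has_gradient_def topspace_Euclidean_space)
  qed
qed

lemma grad_eq:
  assumes "has_gradient d h x v" "x \<in> topspace (Euclidean_space d)"
  shows "grad d h x = v"
  unfolding grad_def using assms by (blast intro: has_gradient_unique)

lemma has_gradient_add:
  assumes "has_gradient d h x v" "has_gradient d k x w"
  shows "has_gradient d (\<lambda>y. h y + k y) x (\<lambda>j. v j + w j)"
  unfolding has_gradient_def
proof (intro conjI allI impI)
  show "(\<lambda>j. v j + w j) \<in> topspace (Euclidean_space d)"
    using assms by (simp add: has_gradient_def topspace_Euclidean_space)
  fix e :: real assume "e > 0"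
  then have e: "e / 2 > 0" by simp
  obtain r where r: "r > 0" "\<And>y. y \<in> topspace (Euclidean_space d) \<Longrightarrow>
      norm_Rd d (\<lambda>j. y j - x j) < r \<Longrightarrow>
      \<bar>h y - h x - inner_Rd d v (\<lambda>j. y j - x j)\<bar> \<le> e / 2 * norm_Rd d (\<lambda>j. y j - x j)"
    using assms(1) e unfolding has_gradient_def by blast
  obtain s where s: "s > 0" "\<And>y. y \<in> topspace (Euclidean_space d) \<Longrightarrow>
      norm_Rd d (\<lambda>j. y j - x j) < s \<Longrightarrow>
      \<bar>k y - k x - inner_Rd d w (\<lambda>j. y j - x j)\<bar> \<le> e / 2 * norm_Rd d (\<lambda>j. y j - x j)"
    using assms(2) e unfolding has_gradient_def by blast
  have add: "inner_Rd d (\<lambda>j. v j + w j) z = inner_Rd d v z + inner_Rd d w z" for z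
    by (simp add: inner_Rd_def sum.distrib algebra_simps)
  show "\<exists>\<delta>>0. \<forall>y\<in>topspace (Euclidean_space d). norm_Rd d (\<lambda>j. y j - x j) < \<delta> \<longrightarrow>
      \<bar>h y + k y - (h x + k x) - inner_Rd d (\<lambda>j. v j + w j) (\<lambda>j. y j - x j)\<bar>
        \<le> e * norm_Rd d (\<lambda>j. y j - x j)"
  proof (intro exI[of _ "min r s"] conjI ballI impI)
    show "min r s > 0" using r s by simp
    fix y assume y: "y \<in> topspace (Euclidean_space d)" "norm_Rd d (\<lambda>j. y j - x j) < min r s"
    have "e / 2 * norm_Rd d (\<lambda>j. y j - x j) + e / 2 * norm_Rd d (\<lambda>j. y j - x j)
        = e * norm_Rd d (\<lambda>j. y j - x j)"
      by simp
    then show "\<bar>h y + k y - (h x + k x) - inner_Rd d (\<lambda>j. v j + w j) (\<lambda>j. y j - x j)\<bar>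
        \<le> e * norm_Rd d (\<lambda>j. y j - x j)"
      using r(2)[of y] s(2)[of y] y unfolding add by linarith
  qed
qed

lemma has_gradient_const: "has_gradient d (\<lambda>_. c) x (\<lambda>_. 0)"
  unfolding has_gradient_def
  by (auto simp: topspace_Euclidean_space inner_Rd_def norm_Rd_nonneg intro: exI[of _ 1])

lemma has_gradient_sum:
  assumes "finite I" "\<And>i. i \<in> I \<Longrightarrow> has_gradient d (h i) x (v i)"
  shows "has_gradient d (\<lambda>y. \<Sum>i\<in>I. h i y) x (\<lambda>j. \<Sum>i\<in>I. v i j)"
  using assms
  by (induction I rule: finite_induct) (simp_all add: has_gradient_const has_gradient_add)

lemma has_gradient_divide:
  assumes "has_gradient d h x v" "c > 0"
  shows "has_gradient d (\<lambda>y. h y / c) x (\<lambda>j. v j / c)"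
  unfolding has_gradient_def
proof (intro conjI allI impI)
  show "(\<lambda>j. v j / c) \<in> topspace (Euclidean_space d)"
    using assms by (simp add: has_gradient_def topspace_Euclidean_space)
  fix e :: real assume "e > 0"
  then have "e * c > 0" using assms by simp
  then obtain r where r: "r > 0" "\<And>y. y \<in> topspace (Euclidean_space d) \<Longrightarrow>
      norm_Rd d (\<lambda>j. y j - x j) < r \<Longrightarrow>
      \<bar>h y - h x - inner_Rd d v (\<lambda>j. y j - x j)\<bar> \<le> e * c * norm_Rd d (\<lambda>j. y j - x j)"
    using assms(1) unfolding has_gradient_def by blast
  have "\<bar>h y / c - h x / c - inner_Rd d (\<lambda>j. v j / c) z\<bar> = \<bar>h y - h x - inner_Rd d v z\<bar> / c" for y z
  proof -
    have "inner_Rd d (\<lambda>j. v j / c) z = inner_Rd d v z / c"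
      by (simp add: inner_Rd_def sum_divide_distrib)
    then show ?thesis
      using assms(2) by (simp flip: diff_divide_distrib)
  qed
  then show "\<exists>\<delta>>0. \<forall>y\<in>topspace (Euclidean_space d). norm_Rd d (\<lambda>j. y j - x j) < \<delta> \<longrightarrow>
      \<bar>h y / c - h x / c - inner_Rd d (\<lambda>j. v j / c) (\<lambda>j. y j - x j)\<bar>
        \<le> e * norm_Rd d (\<lambda>j. y j - x j)"
    using r assms(2) by (intro exI[of _ r]) (auto simp: field_simps)
qed

text \<open>
  The mean value theorem along the segment. Bounding the gradient at the intermediate point by
  smoothness gives the constant \<open>L\<close> instead of the sharp \<open>L / 2\<close>.
\<close>

lemma smooth_descent:
  assumes X: "X \<subseteq> topspace (Euclidean_space d)" "convex_Rd X"
    and diff: "\<And>z. z \<in> X \<Longrightarrow> has_gradient d h z (grad d h z)"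
    and smooth: "smooth_on_Rd d L h X" and L: "L \<ge> 0"
    and x: "x \<in> X" and y: "y \<in> X"
  shows "h y \<le> h x + inner_Rd d (grad d h x) (\<lambda>j. y j - x j) + L * (norm_Rd d (\<lambda>j. y j - x j))\<^sup>2"
proof -
  define u where "u = (\<lambda>j. y j - x j)"
  define z where "z = (\<lambda>t j. x j + t * u j)"
  have zX: "z t \<in> X" if "t \<in> {0..1}" for t
  proof -
    have "(\<lambda>j. (1 - t) * x j + t * y j) \<in> X"
      using X(2) x y that unfolding convex_Rd_def by blast
    also have "(\<lambda>j. (1 - t) * x j + t * y j) = z t"
      by (auto simp: z_def u_def algebra_simps)
    finally show ?thesis .
  qed
  have xt: "x \<in> topspace (Euclidean_space d)" and "y \<in> topspace (Euclidean_space d)"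
    using X(1) x y by blast+
  then have ut: "u \<in> topspace (Euclidean_space d)"
    by (simp add: u_def topspace_Euclidean_space)
  have der: "((\<lambda>t. h (z t)) has_real_derivative inner_Rd d (grad d h (z t)) u) (at t)"
    if "t \<in> {0..1}" for t
    unfolding z_def using diff[OF zX[OF that]] xt ut
    by (intro has_gradient_DERIV_line) (simp_all add: z_def)
  obtain t where t: "0 < t" "t < 1" and
    mvt: "h (z 1) - h (z 0) = (1 - 0) * inner_Rd d (grad d h (z t)) u"
    using MVT2[of 0 1 "\<lambda>t. h (z t)" "\<lambda>t. inner_Rd d (grad d h (z t)) u"] der by auto
  have tX: "z t \<in> X" using zX t by simp
  have z01: "z 0 = x" "z 1 = y"
    by (auto simp: z_def u_def)
  have "norm_Rd d (\<lambda>j. grad d h (z t) j - grad d h x j) \<le> L * norm_Rd d (\<lambda>j. z t j - x j)"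
    using smooth tX x unfolding smooth_on_Rd_def by blast
  also have "\<dots> = L * (t * norm_Rd d u)"
    using t by (simp add: z_def norm_Rd_scale)
  also have "\<dots> \<le> L * (1 * norm_Rd d u)"
    using t L norm_Rd_nonneg by (intro mult_left_mono mult_right_mono) auto
  finally have "norm_Rd d (\<lambda>j. grad d h (z t) j - grad d h x j) * norm_Rd d u
      \<le> L * norm_Rd d u * norm_Rd d u"
    by (intro mult_right_mono) (auto simp: norm_Rd_nonneg)
  then have "inner_Rd d (\<lambda>j. grad d h (z t) j - grad d h x j) u \<le> L * (norm_Rd d u)\<^sup>2"
    using inner_Rd_Cauchy_Schwarz[of d "\<lambda>j. grad d h (z t) j - grad d h x j" u]
    by (simp add: power2_eq_square)
  then show ?thesis
    using mvt by (simp add: z01 inner_Rd_diff_left u_def)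
qed

section \<open>Finitely supported expectations and mini-batches\<close>

lemma expectation_bind_finite:
  fixes h :: "'b \<Rightarrow> real"
  assumes "finite (set_pmf P)" "\<And>x. x \<in> set_pmf P \<Longrightarrow> finite (set_pmf (F x))"
  shows "measure_pmf.expectation (P \<bind> F) h
    = measure_pmf.expectation P (\<lambda>x. measure_pmf.expectation (F x) h)"
  using assms by (subst pmf_expectation_bind[of "set_pmf P"]) (auto simp: integral_measure_pmf[of "set_pmf P"])

lemma expectation_mono_finite:
  fixes h k :: "'a \<Rightarrow> real"
  assumes "finite (set_pmf P)" "\<And>x. x \<in> set_pmf P \<Longrightarrow> h x \<le> k x"
  shows "measure_pmf.expectation P h \<le> measure_pmf.expectation P k"
  using assms by (intro integral_mono_AE integrable_measure_pmf_finite) (auto simp: AE_measure_pmf_iff)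

lemma finite_set_replicate_pmf:
  assumes "finite (set_pmf P)"
  shows "finite (set_pmf (replicate_pmf m P))"
  using finite_lists_length_eq[OF assms, of m]
  by (simp add: set_replicate_pmf lists_eq_set Collect_conj_eq)

lemma expectation_replicate_Suc:
  fixes h :: "'a list \<Rightarrow> real"
  assumes "finite (set_pmf P)"
  shows "measure_pmf.expectation (replicate_pmf (Suc m) P) h
    = measure_pmf.expectation P (\<lambda>x. measure_pmf.expectation (replicate_pmf m P) (\<lambda>xs. h (x # xs)))"
  using assms finite_set_replicate_pmf[OF assms, of m]
  by (simp add: expectation_bind_finite)

lemma expectation_replicate_snoc:
  fixes h :: "'a list \<Rightarrow> real"
  assumes "finite (set_pmf P)"
  shows "measure_pmf.expectation (replicate_pmf (Suc m) P) h
    = measure_pmf.expectation (replicate_pmf m P) (\<lambda>xs. measure_pmf.expectation P (\<lambda>x. h (xs @ [x])))"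
proof -
  have "replicate_pmf (Suc m) P = replicate_pmf m P \<bind> (\<lambda>xs. P \<bind> (\<lambda>x. return_pmf (xs @ [x])))"
    using replicate_pmf_distrib[of m 1 P]
    by (simp add: bind_assoc_pmf bind_return_pmf)
  then show ?thesis
    using assms finite_set_replicate_pmf[OF assms, of m] by (simp add: expectation_bind_finite)
qed

text \<open>Independent centred summands are uncorrelated, so second moments add up.\<close>

lemma second_moment_replicate:
  fixes h :: "'a \<Rightarrow> real"
  assumes fin: "finite (set_pmf P)" and mean: "measure_pmf.expectation P h = 0"
  shows "measure_pmf.expectation (replicate_pmf m P) (\<lambda>xs. (c + (\<Sum>x\<leftarrow>xs. h x))\<^sup>2)
    = c\<^sup>2 + real m * measure_pmf.expectation P (\<lambda>x. (h x)\<^sup>2)"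
proof (induction m arbitrary: c)
  case 0
  then show ?case by simp
next
  case (Suc m)
  note int = integrable_measure_pmf_finite[OF fin]
  let ?V = "measure_pmf.expectation P (\<lambda>x. (h x)\<^sup>2)"
  have "measure_pmf.expectation (replicate_pmf (Suc m) P) (\<lambda>xs. (c + (\<Sum>x\<leftarrow>xs. h x))\<^sup>2)
    = measure_pmf.expectation P (\<lambda>x. measure_pmf.expectation (replicate_pmf m P)
        (\<lambda>xs. ((c + h x) + (\<Sum>x\<leftarrow>xs. h x))\<^sup>2))"
    using fin by (subst expectation_replicate_Suc) (simp_all add: add.assoc)
  also have "\<dots> = measure_pmf.expectation P (\<lambda>x. (c\<^sup>2 + real m * ?V) + (2 * c * h x + (h x)\<^sup>2))"
    unfolding Suc.IH by (simp add: power2_sum algebra_simps)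
  also have "\<dots> = c\<^sup>2 + real (Suc m) * ?V"
    by (simp add: int mean algebra_simps)
  finally show ?case .
qed

text \<open>
  The error of a mini-batch correction \<open>u\<close>: it is unbiased, hence its variance, which is at most the
  averaged second moment divided by the batch size, is simply added to the previous squared error.
\<close>

lemma minibatch_error:
  fixes u :: "nat \<Rightarrow> rvec"
  assumes n: "n \<ge> 1" and b: "b \<ge> 1"
  shows "measure_pmf.expectation (replicate_pmf b (pmf_of_set {1..n}))
      (\<lambda>is. (norm_Rd d (\<lambda>j. e j + (\<Sum>i\<leftarrow>is. u i j) / real b - (\<Sum>i=1..n. u i j) / real n))\<^sup>2)
    \<le> (norm_Rd d e)\<^sup>2 + (\<Sum>i=1..n. (norm_Rd d (u i))\<^sup>2) / real n / real b"
proof -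
  let ?Q = "pmf_of_set {1..n}"
  let ?R = "replicate_pmf b ?Q"
  define m where "m j = (\<Sum>i=1..n. u i j) / real n" for j
  define h where "h j i = (u i j - m j) / real b" for i j
  have fin: "finite (set_pmf ?Q)" and finR: "finite (set_pmf ?R)"
    using n by (auto intro!: finite_set_replicate_pmf)
  have EQ: "measure_pmf.expectation ?Q k = (\<Sum>i=1..n. k i) / real n" for k :: "nat \<Rightarrow> real"
    using n by (simp add: integral_pmf_of_set)
  have mean: "measure_pmf.expectation ?Q (h j) = 0" for j
    unfolding EQ using n by (simp add: h_def sum_subtractf m_def flip: sum_divide_distrib)
  have var: "measure_pmf.expectation ?Q (\<lambda>i. (h j i)\<^sup>2) \<le> (\<Sum>i=1..n. (u i j)\<^sup>2) / real n / (real b)\<^sup>2" for j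
  proof -
    have "(\<Sum>i=1..n. (u i j - m j)\<^sup>2)
        = (\<Sum>i=1..n. (u i j)\<^sup>2) - 2 * m j * (\<Sum>i=1..n. u i j) + real n * (m j)\<^sup>2"
      by (simp add: power2_diff sum.distrib sum_subtractf sum_distrib_left mult_ac)
    also have "(\<Sum>i=1..n. u i j) = real n * m j"
      using n by (simp add: m_def)
    finally have "(\<Sum>i=1..n. (u i j - m j)\<^sup>2) \<le> (\<Sum>i=1..n. (u i j)\<^sup>2)"
      by (simp add: power2_eq_square)
    then have "(\<Sum>i=1..n. (u i j - m j)\<^sup>2) / real n / (real b)\<^sup>2 \<le> (\<Sum>i=1..n. (u i j)\<^sup>2) / real n / (real b)\<^sup>2"
      by (intro divide_right_mono) auto
    then show ?thesis
      unfolding EQ by (simp add: h_def power_divide mult.commute flip: sum_divide_distrib)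
  qed
  have "measure_pmf.expectation ?R
      (\<lambda>is. (norm_Rd d (\<lambda>j. e j + (\<Sum>i\<leftarrow>is. u i j) / real b - m j))\<^sup>2)
    = measure_pmf.expectation ?R (\<lambda>is. \<Sum>j<d. (e j + (\<Sum>i\<leftarrow>is. h j i))\<^sup>2)"
  proof (rule integral_cong_AE)
    show "AE is in ?R. (norm_Rd d (\<lambda>j. e j + (\<Sum>i\<leftarrow>is. u i j) / real b - m j))\<^sup>2
        = (\<Sum>j<d. (e j + (\<Sum>i\<leftarrow>is. h j i))\<^sup>2)"
      unfolding AE_measure_pmf_iff
    proof
      fix "is" assume "is \<in> set_pmf ?R"
      then have len: "length is = b"
        by (simp add: set_replicate_pmf)
      have "(\<Sum>i\<leftarrow>is. h j i) = ((\<Sum>i\<leftarrow>is. u i j) - real (length is) * m j) / real b" for j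
        by (induction "is") (simp_all add: h_def add_divide_distrib diff_divide_distrib algebra_simps)
      then have "(\<Sum>i\<leftarrow>is. h j i) = (\<Sum>i\<leftarrow>is. u i j) / real b - m j" for j
        using b by (simp add: len diff_divide_distrib)
      then show "(norm_Rd d (\<lambda>j. e j + (\<Sum>i\<leftarrow>is. u i j) / real b - m j))\<^sup>2
          = (\<Sum>j<d. (e j + (\<Sum>i\<leftarrow>is. h j i))\<^sup>2)"
        by (simp add: norm_Rd_power2 add_diff_eq)
    qed
  qed simp_all
  also have "\<dots> = (\<Sum>j<d. measure_pmf.expectation ?R (\<lambda>is. (e j + (\<Sum>i\<leftarrow>is. h j i))\<^sup>2))"
    by (intro Bochner_Integration.integral_sum integrable_measure_pmf_finite finR)
  also have "\<dots> = (\<Sum>j<d. (e j)\<^sup>2 + real b * measure_pmf.expectation ?Q (\<lambda>i. (h j i)\<^sup>2))"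
    by (simp only: second_moment_replicate[OF fin mean])
  also have "\<dots> \<le> (\<Sum>j<d. (e j)\<^sup>2 + real b * ((\<Sum>i=1..n. (u i j)\<^sup>2) / real n / (real b)\<^sup>2))"
    by (intro sum_mono add_left_mono mult_left_mono var) auto
  also have "\<dots> = (\<Sum>j<d. (e j)\<^sup>2) + (\<Sum>j<d. \<Sum>i=1..n. (u i j)\<^sup>2) / real n / real b"
  proof -
    have average: "real b * (S / real n / (real b)\<^sup>2) = S / real n / real b" for S
      using b by (simp add: power2_eq_square)
    show ?thesis
      unfolding average by (simp only: sum.distrib sum_divide_distrib)
  qed
  also have "(\<Sum>j<d. \<Sum>i=1..n. (u i j)\<^sup>2) = (\<Sum>i=1..n. (norm_Rd d (u i))\<^sup>2)"
    unfolding norm_Rd_power2 by (rule sum.swap)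
  finally show ?thesis
    by (simp add: m_def norm_Rd_power2)
qed

section \<open>One iteration\<close>

text \<open>
  The optimisation problem: an average of smooth functions over a convex set of diameter at most
  \<open>D\<close>, the average being convex, with a minimizer \<open>xstar\<close>. The bounds \<open>Li\<close> on the smoothness of the
  individual components enter only through the variance of the gradient estimates.
\<close>

locale finite_sum_problem =
  fixes d n :: nat and L D :: real and Li :: "nat \<Rightarrow> real" and X :: "rvec set"
    and fs :: "nat \<Rightarrow> rvec \<Rightarrow> real" and xstar :: rvec
  assumes n_pos: "n \<ge> 1" and L_pos: "L > 0"
    and convex_X: "convex_Rd X"
    and X_subset: "X \<subseteq> topspace (Euclidean_space d)"
    and diameter: "\<And>x y. x \<in> X \<Longrightarrow> y \<in> X \<Longrightarrow> norm_Rd d (\<lambda>j. x j - y j) \<le> D"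
    and differentiable: "\<And>i. i \<in> {1..n} \<Longrightarrow> differentiable_near d (fs i) X"
    and smooth_avg: "smooth_on_Rd d L (avg_fun n fs) X"
    and smooth_component: "\<And>i. i \<in> {1..n} \<Longrightarrow> smooth_on_Rd d (Li i) (fs i) X"
    and convex_avg: "grad_convex_on d (avg_fun n fs) X"
    and minimizer: "is_arg_min (avg_fun n fs) (\<lambda>x. x \<in> X) xstar"
begin

abbreviation "f \<equiv> avg_fun n fs"

lemma xstar_mem: "xstar \<in> X" and f_xstar_le: "x \<in> X \<Longrightarrow> f xstar \<le> f x"
  using minimizer by (auto simp: is_arg_min_def not_less)

lemma has_gradient_component:
  assumes "i \<in> {1..n}" "x \<in> X"
  shows "has_gradient d (fs i) x (grad d (fs i) x)"
proof -
  obtain v where "has_gradient d (fs i) x v"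
    using differentiable[OF assms(1)] assms(2) unfolding differentiable_near_def by blast
  moreover from this have "grad d (fs i) x = v"
    using assms(2) X_subset by (blast intro: grad_eq)
  ultimately show ?thesis by simp
qed

lemma
  assumes x: "x \<in> X"
  shows grad_avg: "grad d f x = (\<lambda>j. (\<Sum>i=1..n. grad d (fs i) x j) / real n)"
    and has_gradient_avg: "has_gradient d f x (grad d f x)"
proof -
  have "has_gradient d f x (\<lambda>j. (\<Sum>i=1..n. grad d (fs i) x j) / real n)"
    unfolding avg_fun_def using n_pos x
    by (intro has_gradient_divide has_gradient_sum has_gradient_component) auto
  moreover from this show "grad d f x = (\<lambda>j. (\<Sum>i=1..n. grad d (fs i) x j) / real n)"
    using x X_subset by (blast intro: grad_eq)
  ultimately show "has_gradient d f x (grad d f x)" by simp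
qed

text \<open>
  Inexact Frank-Wolfe descent. Because \<open>s\<close> is optimal for the estimate \<open>g\<close>, replacing \<open>g\<close> by the true
  gradient costs only the product of the estimation error with the distance from \<open>s\<close> to \<open>xstar\<close>.
\<close>

lemma frank_wolfe_descent:
  assumes x: "x \<in> X" and \<eta>: "0 \<le> \<eta>" and s: "is_arg_min (inner_Rd d g) (\<lambda>s. s \<in> X) s"
    and x': "(\<lambda>j. x j + \<eta> * (s j - x j)) \<in> X" (is "?x' \<in> X")
  shows "f ?x' - f xstar \<le> (1 - \<eta>) * (f x - f xstar)
    + \<eta> * (D * norm_Rd d (\<lambda>j. g j - grad d f x j)) + L * \<eta>\<^sup>2 * D\<^sup>2"
proof -
  let ?G = "grad d f x" and ?N = "norm_Rd d (\<lambda>j. g j - grad d f x j)"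
  have sX: "s \<in> X" and opt: "inner_Rd d g s \<le> inner_Rd d g xstar"
    using s xstar_mem by (auto simp: is_arg_min_def not_less)
  have diff: "(\<lambda>j. ?x' j - x j) = (\<lambda>j. \<eta> * (s j - x j))" by auto
  have "f ?x' \<le> f x + \<eta> * inner_Rd d ?G (\<lambda>j. s j - x j) + L * (norm_Rd d (\<lambda>j. \<eta> * (s j - x j)))\<^sup>2"
    using smooth_descent[OF X_subset convex_X has_gradient_avg smooth_avg _ x x'] L_pos
    by (simp add: diff inner_Rd_scale_right)
  moreover have "(norm_Rd d (\<lambda>j. \<eta> * (s j - x j)))\<^sup>2 \<le> (\<eta> * D)\<^sup>2"
    using diameter[OF sX x] \<eta> norm_Rd_nonneg by (simp add: norm_Rd_scale power_mono mult_left_mono)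
  then have "L * (norm_Rd d (\<lambda>j. \<eta> * (s j - x j)))\<^sup>2 \<le> L * (\<eta> * D)\<^sup>2"
    using L_pos by (intro mult_left_mono) auto
  moreover have "inner_Rd d ?G (\<lambda>j. s j - x j) \<le> D * ?N - (f x - f xstar)"
  proof -
    have "- inner_Rd d (\<lambda>j. g j - ?G j) (\<lambda>j. s j - xstar j) \<le> ?N * norm_Rd d (\<lambda>j. s j - xstar j)"
      using inner_Rd_Cauchy_Schwarz[of d "\<lambda>j. g j - ?G j" "\<lambda>j. s j - xstar j"] by linarith
    also have "\<dots> \<le> ?N * D"
      by (intro mult_left_mono diameter sX xstar_mem norm_Rd_nonneg)
    finally have "inner_Rd d ?G s - inner_Rd d ?G xstar \<le> D * ?N"
      using opt by (simp add: inner_Rd_diff_left inner_Rd_diff_right algebra_simps)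
    moreover have "f x + inner_Rd d ?G (\<lambda>j. xstar j - x j) \<le> f xstar"
      using convex_avg x xstar_mem unfolding grad_convex_on_def by blast
    ultimately show ?thesis by (simp add: inner_Rd_diff_right)
  qed
  then have "\<eta> * inner_Rd d ?G (\<lambda>j. s j - x j) \<le> \<eta> * (D * ?N - (f x - f xstar))"
    using \<eta> by (rule mult_left_mono)
  ultimately show ?thesis
    by (simp add: algebra_simps power_mult_distrib)
qed

text \<open>
  The gradient estimate that replaces \<open>g\<close> when the iterate moves from \<open>x\<close> to \<open>x'\<close>, for a draw \<open>a\<close>
  consisting of a batch and a coin.
\<close>

definition next_estimate :: "nat \<Rightarrow> rvec \<Rightarrow> rvec \<Rightarrow> rvec \<Rightarrow> draw \<Rightarrow> rvec" where
  "next_estimate b x x' g a =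
     (if snd a then grad d f x'
      else (\<lambda>j. g j + (\<Sum>i\<leftarrow>fst a. grad d (fs i) x' j - grad d (fs i) x j) / real b))"

lemma finite_set_draw: "finite (set_pmf (draw_pmf n b p))"
  using n_pos unfolding draw_pmf_def by (auto intro!: finite_set_replicate_pmf)

lemma estimate_error_contraction:
  assumes x: "x \<in> X" and x': "x' \<in> X" and p: "0 < p" "p \<le> 1" and b: "b \<ge> 1"
  shows "measure_pmf.expectation (draw_pmf n b p)
      (\<lambda>a. (norm_Rd d (\<lambda>j. next_estimate b x x' g a j - grad d f x' j))\<^sup>2)
    \<le> (1 - p) * ((norm_Rd d (\<lambda>j. g j - grad d f x j))\<^sup>2
        + (\<Sum>i=1..n. (Li i)\<^sup>2) / real n / real b * (norm_Rd d (\<lambda>j. x' j - x j))\<^sup>2)"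
proof -
  let ?R = "replicate_pmf b (pmf_of_set {1..n})" and ?r = "norm_Rd d (\<lambda>j. x' j - x j)"
  let ?e = "\<lambda>j. g j - grad d f x j"
  define u where "u i = (\<lambda>j. grad d (fs i) x' j - grad d (fs i) x j)" for i
  let ?h = "\<lambda>a. (norm_Rd d (\<lambda>j. next_estimate b x x' g a j - grad d f x' j))\<^sup>2"
  have fin: "finite (set_pmf ?R)"
    using n_pos by (intro finite_set_replicate_pmf) auto
  have "?h (is, False)
      = (norm_Rd d (\<lambda>j. ?e j + (\<Sum>i\<leftarrow>is. u i j) / real b - (\<Sum>i=1..n. u i j) / real n))\<^sup>2" for "is"
    using x x' by (simp add: next_estimate_def u_def grad_avg sum_subtractf diff_divide_distrib algebra_simps)
  then have "measure_pmf.expectation ?R (\<lambda>is. ?h (is, False))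
      \<le> (norm_Rd d ?e)\<^sup>2 + (\<Sum>i=1..n. (norm_Rd d (u i))\<^sup>2) / real n / real b"
    using minibatch_error[OF n_pos b, of d ?e u] by simp
  also have "(\<Sum>i=1..n. (norm_Rd d (u i))\<^sup>2) \<le> (\<Sum>i=1..n. (Li i)\<^sup>2 * ?r\<^sup>2)"
  proof (rule sum_mono)
    fix i assume i: "i \<in> {1..n}"
    have "norm_Rd d (u i) \<le> Li i * ?r"
      using smooth_component[OF i] x x' unfolding smooth_on_Rd_def u_def by blast
    then show "(norm_Rd d (u i))\<^sup>2 \<le> (Li i)\<^sup>2 * ?r\<^sup>2"
      using norm_Rd_nonneg[of d "u i"] by (simp add: power_mono flip: power_mult_distrib)
  qed
  then have "(norm_Rd d ?e)\<^sup>2 + (\<Sum>i=1..n. (norm_Rd d (u i))\<^sup>2) / real n / real b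
      \<le> (norm_Rd d ?e)\<^sup>2 + (\<Sum>i=1..n. (Li i)\<^sup>2) / real n / real b * ?r\<^sup>2"
    by (simp add: divide_right_mono flip: sum_distrib_right)
  finally have "(1 - p) * measure_pmf.expectation ?R (\<lambda>is. ?h (is, False))
      \<le> (1 - p) * ((norm_Rd d ?e)\<^sup>2 + (\<Sum>i=1..n. (Li i)\<^sup>2) / real n / real b * ?r\<^sup>2)"
    using p by (intro mult_left_mono) auto
  moreover have "measure_pmf.expectation (draw_pmf n b p) ?h
      = (1 - p) * measure_pmf.expectation ?R (\<lambda>is. ?h (is, False))"
  proof -
    have zero: "?h (is, True) = 0" for "is"
      by (simp add: next_estimate_def norm_Rd_power2)
    have "measure_pmf.expectation (draw_pmf n b p) ?h
        = measure_pmf.expectation ?R (\<lambda>is. measure_pmf.expectation (bernoulli_pmf p) (\<lambda>c. ?h (is, c)))"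
      unfolding draw_pmf_def pair_pmf_def using fin by (simp add: expectation_bind_finite)
    also have "\<dots> = measure_pmf.expectation ?R (\<lambda>is. (1 - p) * ?h (is, False))"
      using p by (simp add: zero mult.commute)
    finally show ?thesis by simp
  qed
  ultimately show ?thesis by simp
qed

text \<open>The potential: optimality gap plus weighted squared error of the gradient estimate.\<close>

definition potential :: "real \<Rightarrow> rvec \<times> rvec \<Rightarrow> real" where
  "potential \<alpha> z = f (fst z) - f xstar + \<alpha> * (norm_Rd d (\<lambda>j. snd z j - grad d f (fst z) j))\<^sup>2"

text \<open>The smoothness constant that accounts for the variance of the gradient estimates.\<close>

definition effective_smoothness :: "nat \<Rightarrow> real \<Rightarrow> real" where
  "effective_smoothness b p =
     L + sqrt ((\<Sum>i=1..n. (Li i)\<^sup>2) / real n) * sqrt ((1 - p) / (p * real b))"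

text \<open>
  Young's inequality splits the product of step size, diameter and error. Its quadratic error term
  uses up half of the decrease of the squared error by the factor \<open>1 - p\<close>; the other half yields
  the factor \<open>1 - \<eta>\<close>, because \<open>\<eta> \<le> p / 2\<close>. The weight \<open>1 / (p * A)\<close>, with \<open>A\<close> the effective
  smoothness, keeps both remainders of order \<open>A * (\<eta> * D)\<^sup>2\<close>, also when \<open>p = 1\<close>.
\<close>

lemma potential_step:
  assumes x: "x \<in> X" and \<eta>: "0 \<le> \<eta>" "\<eta> \<le> p / 2" and s: "is_arg_min (inner_Rd d g) (\<lambda>s. s \<in> X) s"
    and x': "(\<lambda>j. x j + \<eta> * (s j - x j)) \<in> X" (is "?x' \<in> X")
    and p: "0 < p" "p \<le> 1" and b: "b \<ge> 1"
  defines "A \<equiv> effective_smoothness b p"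
  defines "\<alpha> \<equiv> 1 / (p * A)"
  shows "measure_pmf.expectation (draw_pmf n b p) (\<lambda>a. potential \<alpha> (?x', next_estimate b x ?x' g a))
    \<le> (1 - \<eta>) * potential \<alpha> (x, g) + \<eta>\<^sup>2 * (3 / 2 * A * D\<^sup>2)"
proof -
  let ?E = "measure_pmf.expectation (draw_pmf n b p)
      (\<lambda>a. (norm_Rd d (\<lambda>j. next_estimate b x ?x' g a j - grad d f ?x' j))\<^sup>2)"
  define N where "N = norm_Rd d (\<lambda>j. g j - grad d f x j)"
  define V where "V = (\<Sum>i=1..n. (Li i)\<^sup>2) / real n / real b"
  define c where "c = sqrt ((\<Sum>i=1..n. (Li i)\<^sup>2) / real n) * sqrt ((1 - p) / (p * real b))"
  have V: "V \<ge> 0" by (simp add: V_def sum_nonneg)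
  have c: "c \<ge> 0" using p by (simp add: c_def sum_nonneg)
  have c2: "(1 - p) * V = p * c\<^sup>2"
  proof -
    have "c\<^sup>2 = (\<Sum>i=1..n. (Li i)\<^sup>2) / real n * ((1 - p) / (p * real b))"
      using p by (simp add: c_def power_mult_distrib sum_nonneg)
    then have "p * c\<^sup>2 = (\<Sum>i=1..n. (Li i)\<^sup>2) / real n * (p * ((1 - p) / (p * real b)))"
      by (metis mult.left_commute)
    also have "p * ((1 - p) / (p * real b)) = (1 - p) / real b"
      using p by simp
    also have "(\<Sum>i=1..n. (Li i)\<^sup>2) / real n * ((1 - p) / real b) = (1 - p) * V"
      by (simp add: V_def)
    finally show ?thesis by (rule sym)
  qed
  have A: "A = L + c" "A > 0"
    using L_pos c by (auto simp: A_def effective_smoothness_def c_def)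
  have \<alpha>: "\<alpha> > 0" using A p by (simp add: \<alpha>_def)
  have sX: "s \<in> X" using s by (simp add: is_arg_min_def)
  have "norm_Rd d (\<lambda>j. ?x' j - x j) \<le> \<eta> * D"
    using diameter[OF sX x] \<eta> by (simp add: norm_Rd_scale mult_left_mono)
  then have "(norm_Rd d (\<lambda>j. ?x' j - x j))\<^sup>2 \<le> (\<eta> * D)\<^sup>2"
    by (intro power_mono norm_Rd_nonneg)
  then have "V * (norm_Rd d (\<lambda>j. ?x' j - x j))\<^sup>2 \<le> V * (\<eta> * D)\<^sup>2"
    using V by (rule mult_left_mono)
  then have "(1 - p) * (N\<^sup>2 + V * (norm_Rd d (\<lambda>j. ?x' j - x j))\<^sup>2) \<le> (1 - p) * (N\<^sup>2 + V * (\<eta> * D)\<^sup>2)"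
    using p by (intro mult_left_mono) auto
  also have "\<dots> = (1 - p) * N\<^sup>2 + p * c\<^sup>2 * (\<eta> * D)\<^sup>2"
    by (simp only: distrib_left mult.assoc[symmetric] c2)
  finally have "?E \<le> (1 - p) * N\<^sup>2 + p * c\<^sup>2 * (\<eta> * D)\<^sup>2"
    using estimate_error_contraction[OF x x' p b, of g] unfolding N_def V_def by linarith
  then have "\<alpha> * ?E \<le> \<alpha> * ((1 - p) * N\<^sup>2 + p * c\<^sup>2 * (\<eta> * D)\<^sup>2)"
    using \<alpha> by (intro mult_left_mono) auto
  also have "\<dots> = \<alpha> * (1 - p) * N\<^sup>2 + c\<^sup>2 / A * (\<eta> * D)\<^sup>2"
    using p A(2) by (simp add: \<alpha>_def distrib_left)
  also have "c\<^sup>2 / A * (\<eta> * D)\<^sup>2 \<le> c * (\<eta> * D)\<^sup>2"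
  proof (rule mult_right_mono)
    show "c\<^sup>2 / A \<le> c"
      using A c L_pos by (simp add: field_simps power2_eq_square)
  qed simp
  finally have E: "\<alpha> * ?E \<le> \<alpha> * (1 - p) * N\<^sup>2 + c * (\<eta> * D)\<^sup>2" by simp
  have young: "\<eta> * (D * N) \<le> \<alpha> * (p / 2) * N\<^sup>2 + A / 2 * (\<eta> * D)\<^sup>2"
  proof -
    have "2 * A * (\<eta> * (D * N)) \<le> N\<^sup>2 + (A * (\<eta> * D))\<^sup>2"
      using sum_squares_bound[of N "A * (\<eta> * D)"] by (simp add: mult_ac)
    then have "\<eta> * (D * N) \<le> (N\<^sup>2 + (A * (\<eta> * D))\<^sup>2) / (2 * A)"
      using A(2) by (simp add: field_simps)
    also have "\<dots> = \<alpha> * (p / 2) * N\<^sup>2 + A / 2 * (\<eta> * D)\<^sup>2"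
      using A(2) p by (simp add: \<alpha>_def field_simps power2_eq_square)
    finally show ?thesis .
  qed
  have "\<alpha> * N\<^sup>2 * (1 - p / 2) \<le> \<alpha> * N\<^sup>2 * (1 - \<eta>)"
    using \<alpha> \<eta> by (intro mult_left_mono) auto
  then have absorb: "\<alpha> * (1 - p) * N\<^sup>2 + \<alpha> * (p / 2) * N\<^sup>2 \<le> (1 - \<eta>) * (\<alpha> * N\<^sup>2)"
    by (simp add: algebra_simps)
  have "f ?x' - f xstar + \<alpha> * ?E
      \<le> (1 - \<eta>) * (f x - f xstar) + (1 - \<eta>) * (\<alpha> * N\<^sup>2) + (L + c + A / 2) * (\<eta> * D)\<^sup>2"
    using frank_wolfe_descent[OF x \<eta>(1) s x'] E young absorb
    unfolding N_def by (simp add: algebra_simps power_mult_distrib)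
  also have "\<dots> = (1 - \<eta>) * potential \<alpha> (x, g) + \<eta>\<^sup>2 * (3 / 2 * A * D\<^sup>2)"
    by (simp add: A potential_def N_def algebra_simps power_mult_distrib)
  finally show ?thesis
    unfolding potential_def fst_conv snd_conv
    by (simp add: integrable_measure_pmf_finite[OF finite_set_draw])
qed

end

section \<open>Step sizes and the scalar recursion\<close>

lemma fw_step_bounds:
  assumes p: "0 < p" "p \<le> 1"
  shows "0 \<le> fw_step p K k" and "fw_step p K k \<le> p / 2"
proof -
  have "0 \<le> 2 / (4 / p + t) \<and> 2 / (4 / p + t) \<le> p / 2" if "0 \<le> t" for t
  proof -
    have "0 < 4 / p" using p by simp
    then have "0 < 4 / p + t" using that by linarith
    moreover have "4 \<le> p * (4 / p + t)"
      using p that by (simp add: distrib_left)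
    ultimately show ?thesis
      by (simp add: field_simps)
  qed
  from this[of "real k - of_int \<lceil>real K / 2\<rceil>"] p
  show "0 \<le> fw_step p K k" "fw_step p K k \<le> p / 2"
    by (auto simp: fw_step_def not_less add_diff_eq)
qed

lemma constant_step_recursion:
  fixes a :: "nat \<Rightarrow> real"
  assumes p: "0 < p" "p \<le> 1" and G: "0 \<le> G"
    and rec: "\<And>k. k < m \<Longrightarrow> a (Suc k) \<le> (1 - p / 2) * a k + (p / 2)\<^sup>2 * G"
  shows "k \<le> m \<Longrightarrow> a k \<le> (1 - p / 2) ^ k * a 0 + p / 2 * G"
proof (induction k)
  case 0
  then show ?case using p G by simp
next
  case (Suc k)
  have "(1 - p / 2) * a k \<le> (1 - p / 2) * ((1 - p / 2) ^ k * a 0 + p / 2 * G)"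
    using Suc p by (intro mult_left_mono) auto
  moreover have "(1 - p / 2) * (z + p / 2 * G) + (p / 2)\<^sup>2 * G = (1 - p / 2) * z + p / 2 * G" for z
    by (simp add: field_simps power2_eq_square)
  then have "(1 - p / 2) * ((1 - p / 2) ^ k * a 0 + p / 2 * G) + (p / 2)\<^sup>2 * G
      = (1 - p / 2) ^ Suc k * a 0 + p / 2 * G"
    by (simp only: power_Suc mult.assoc)
  moreover have "a (Suc k) \<le> (1 - p / 2) * a k + (p / 2)\<^sup>2 * G"
    using rec[of k] Suc.prems by simp
  ultimately show ?case by linarith
qed

text \<open>
  With steps \<open>2 / (q + t)\<close> the bound \<open>v / (q + t)\<close> is inductive for every \<open>v \<ge> 4 * G\<close>.
\<close>

lemma decreasing_step_recursion:
  fixes a :: "nat \<Rightarrow> real"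
  assumes q: "2 \<le> q" and G: "0 \<le> G" and a0: "0 \<le> a 0"
    and rec: "\<And>t. t < m \<Longrightarrow>
      a (Suc t) \<le> (1 - 2 / (q + real t)) * a t + (2 / (q + real t))\<^sup>2 * G"
  shows "t \<le> m \<Longrightarrow> a t \<le> (q * a 0 + 4 * G) / (q + real t)"
proof (induction t)
  case 0
  then show ?case using q G by (simp add: field_simps)
next
  case (Suc t)
  define w v where "w = q + real t" and "v = q * a 0 + 4 * G"
  have w: "2 \<le> w" using q by (simp add: w_def)
  have v: "4 * G \<le> v" "0 \<le> v" using a0 q G by (auto simp: v_def)
  have "a (Suc t) \<le> (1 - 2 / w) * a t + (2 / w)\<^sup>2 * G"
    using rec[of t] Suc.prems by (simp add: w_def)
  also have "\<dots> \<le> (1 - 2 / w) * (v / w) + (2 / w)\<^sup>2 * G"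
    using Suc w by (intro add_right_mono mult_left_mono) (auto simp: v_def w_def)
  also have "\<dots> = (v * (w - 2) + 4 * G) / w\<^sup>2"
    using w by (simp add: field_simps power2_eq_square)
  also have "\<dots> \<le> v * (w - 1) / w\<^sup>2"
    using v by (intro divide_right_mono) (auto simp: algebra_simps)
  also have "\<dots> \<le> v / (w + 1)"
  proof -
    have "v * ((w - 1) * (w + 1)) \<le> v * w\<^sup>2"
      using v by (intro mult_left_mono) (auto simp: algebra_simps power2_eq_square)
    then show ?thesis using w by (simp add: field_simps)
  qed
  finally show ?case by (simp add: w_def v_def add.commute add.left_commute)
qed

lemma power_le_exp:
  fixes p :: real
  assumes p: "0 < p" "p \<le> 1" and k: "real K / 2 \<le> real k"
  shows "(1 - p / 2) ^ k \<le> exp (- (real K * p / 4))"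
proof -
  have "(1 - p / 2) ^ k \<le> exp (- (p / 2)) ^ k"
    using p exp_ge_add_one_self[of "- (p / 2)"] by (intro power_mono) auto
  also have "\<dots> = exp (- (real k * p / 2))"
    by (simp flip: exp_of_nat_mult)
  also have "\<dots> \<le> exp (- (real K * p / 4))"
    using mult_right_mono[OF k, of "p / 2"] p by simp
  finally show ?thesis .
qed

text \<open>
  The constant step \<open>p / 2\<close> reduces the initial value geometrically and leaves an error of at most
  \<open>p / 2 * G\<close>. If \<open>K \<le> 2 / p\<close>, the whole run uses this step and the error is at most \<open>G / K\<close>.
  Otherwise only the first half of the run does, and the decreasing steps of the second half bring
  the error down to order \<open>G / K\<close>.
\<close>

lemma fw_step_recursion:
  fixes a :: "nat \<Rightarrow> real"
  assumes p: "0 < p" "p \<le> 1" and K: "K \<ge> 1" and G: "0 \<le> G" and nonneg: "\<And>k. k \<le> K \<Longrightarrow> 0 \<le> a k"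
    and rec: "\<And>k. k < K \<Longrightarrow> a (Suc k) \<le> (1 - fw_step p K k) * a k + (fw_step p K k)\<^sup>2 * G"
  shows "a K \<le> 12 * (a 0 / p * exp (- (real K * p / 4)) + G / real K)"
proof -
  let ?e = "exp (- (real K * p / 4))"
  have a0: "0 \<le> a 0" using nonneg by simp
  have ae: "0 \<le> a 0 / p * ?e" using a0 p by simp
  have "a 0 * 1 \<le> a 0 * (1 / p)" using a0 p by (intro mult_left_mono) auto
  then have ap: "a 0 * ?e \<le> a 0 / p * ?e" by (intro mult_right_mono) auto
  have GK: "0 \<le> G / real K" using G by simp
  show ?thesis
  proof (cases "real K \<le> 2 / p")
    case True
    then have "a K \<le> (1 - p / 2) ^ K * a 0 + p / 2 * G"
      using rec by (intro constant_step_recursion[OF p G, of K]) (auto simp: fw_step_def)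
    also have "(1 - p / 2) ^ K * a 0 \<le> ?e * a 0"
      using p a0 by (intro mult_right_mono power_le_exp) auto
    also have "p / 2 * G \<le> 1 / real K * G"
      using True p K G by (intro mult_right_mono) (auto simp: field_simps)
    finally have "a K \<le> a 0 * ?e + G / real K" by (simp add: mult.commute)
    then have "a K \<le> a 0 / p * ?e + G / real K" using ap by linarith
    also have "\<dots> \<le> 12 * (a 0 / p * ?e + G / real K)"
    proof -
      have "z \<le> 12 * z" if "0 \<le> z" for z :: real using that by simp
      from this[OF add_nonneg_nonneg[OF ae GK]] show ?thesis .
    qed
    finally show ?thesis .
  next
    case False
    define k0 where "k0 = nat \<lceil>real K / 2\<rceil>"
    have ceil: "\<lceil>real K / 2\<rceil> = int k0" by (simp add: k0_def)
    have k0: "real K / 2 \<le> real k0" "real k0 < real K / 2 + 1"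
      using ceil by linarith+
    then have k0K: "k0 \<le> K" using K by linarith
    have early: "fw_step p K k = p / 2" if "k < k0" for k
      using that False by (simp add: fw_step_def ceil)
    have late: "fw_step p K (k0 + t) = 2 / (4 / p + real t)" for t
      using False by (simp add: fw_step_def ceil)
    have "a k0 \<le> (1 - p / 2) ^ k0 * a 0 + p / 2 * G"
    proof (rule constant_step_recursion[OF p G _ order_refl])
      fix k assume "k < k0"
      then show "a (Suc k) \<le> (1 - p / 2) * a k + (p / 2)\<^sup>2 * G"
        using rec[of k] k0K early[of k] by simp
    qed
    also have "(1 - p / 2) ^ k0 * a 0 \<le> ?e * a 0"
      using p a0 k0 by (intro mult_right_mono power_le_exp) auto
    finally have phase1: "a k0 \<le> ?e * a 0 + p / 2 * G" by simp
    have "a (k0 + t) \<le> (4 / p * a (k0 + 0) + 4 * G) / (4 / p + real t)" if "t \<le> K - k0" for t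
    proof (rule decreasing_step_recursion[OF _ G _ _ that])
      show "2 \<le> 4 / p" using p by (simp add: field_simps)
      show "0 \<le> a (k0 + 0)" using nonneg k0K by simp
      fix t assume "t < K - k0"
      then show "a (k0 + Suc t) \<le> (1 - 2 / (4 / p + real t)) * a (k0 + t)
          + (2 / (4 / p + real t))\<^sup>2 * G"
        using rec[of "k0 + t"] by (simp add: late)
    qed
    from this[of "K - k0"] k0K
    have "a K \<le> (4 / p * a k0 + 4 * G) / (4 / p + (real K - real k0))"
      by simp
    also have "\<dots> \<le> (4 / p * (?e * a 0) + 6 * G) / (4 / p + (real K - real k0))"
    proof (rule divide_right_mono)
      have "4 / p * a k0 \<le> 4 / p * (?e * a 0 + p / 2 * G)"
        using phase1 p by (intro mult_left_mono) auto
      then show "4 / p * a k0 + 4 * G \<le> 4 / p * (?e * a 0) + 6 * G"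
        using p by (simp add: distrib_left)
      show "0 \<le> 4 / p + (real K - real k0)" using p k0K by simp
    qed
    also have "\<dots> = 4 * (a 0 / p * ?e) / (4 / p + (real K - real k0)) + 6 * G / (4 / p + (real K - real k0))"
      by (simp add: add_divide_distrib mult_ac)
    also have "\<dots> \<le> 4 * (a 0 / p * ?e) / 1 + 6 * G / (real K / 2)"
    proof (intro add_mono divide_left_mono)
      have "4 \<le> 4 / p" using p by (simp add: field_simps)
      then show "1 \<le> 4 / p + (real K - real k0)" "real K / 2 \<le> 4 / p + (real K - real k0)"
        using k0 k0K by linarith+
      then show "0 < (4 / p + (real K - real k0)) * 1" "0 < (4 / p + (real K - real k0)) * (real K / 2)"
        using K by (auto intro!: mult_pos_pos)
    qed (use ae G in auto)
    finally show ?thesis using ae by (simp add: distrib_left)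
  qed
qed

section \<open>Runs of the algorithm\<close>

lemma sarah_fw_append:
  "k \<le> length \<omega> \<Longrightarrow>
    sarah_fw d n fs b \<eta> sel x0 (\<omega> @ \<omega>') k = sarah_fw d n fs b \<eta> sel x0 \<omega> k"
  by (induction k) (simp_all add: nth_append)

lemma set_draws_extend:
  assumes "\<omega> \<in> set_pmf (draws_pmf n b p k)" "k \<le> K"
  obtains \<omega>' where "\<omega> @ \<omega>' \<in> set_pmf (draws_pmf n b p K)"
proof -
  obtain \<omega>' where "\<omega>' \<in> set_pmf (draws_pmf n b p (K - k))"
    using set_pmf_not_empty by fast
  then have "\<omega> @ \<omega>' \<in> set_pmf (draws_pmf n b p K)"
    using assms by (auto simp: draws_pmf_def set_replicate_pmf)
  then show ?thesis by (rule that)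
qed

context finite_sum_problem
begin

lemma sarah_fw_snoc:
  assumes "length \<omega> = k" and "sarah_fw d n fs b \<eta> sel x0 \<omega> k = (x, g)"
  defines "x' \<equiv> \<lambda>j. x j + \<eta> k * (sel \<omega> j - x j)"
  shows "sarah_fw d n fs b \<eta> sel x0 (\<omega> @ [a]) (Suc k) = (x', next_estimate b x x' g a)"
  using assms by (cases a) (simp add: sarah_fw_append nth_append Let_def next_estimate_def)

lemma finite_set_draws: "finite (set_pmf (draws_pmf n b p k))"
  unfolding draws_pmf_def by (intro finite_set_replicate_pmf finite_set_draw)

lemma expectation_draws_Suc:
  "measure_pmf.expectation (draws_pmf n b p (Suc k)) h
    = measure_pmf.expectation (draws_pmf n b p k)
        (\<lambda>\<omega>. measure_pmf.expectation (draw_pmf n b p) (\<lambda>a. h (\<omega> @ [a])))"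
  for h :: "draw list \<Rightarrow> real"
  unfolding draws_pmf_def by (rule expectation_replicate_snoc[OF finite_set_draw])

text \<open>
  A run of positive probability of length \<open>k < K\<close> extends to one of length \<open>K\<close>, so the selection
  rule also solves the linear subproblem at its end.
\<close>

lemma lmo_rule_prefix:
  assumes lmo: "lmo_rule d X n fs b p \<eta> x0 K sel"
    and \<omega>: "\<omega> \<in> set_pmf (draws_pmf n b p k)" and k: "k < K"
  shows "is_arg_min (inner_Rd d (snd (sarah_fw d n fs b \<eta> sel x0 \<omega> k))) (\<lambda>s. s \<in> X) (sel \<omega>)"
proof -
  obtain \<omega>' where "\<omega> @ \<omega>' \<in> set_pmf (draws_pmf n b p K)"
    using set_draws_extend[OF \<omega>] k by (meson less_imp_le)
  moreover have "length \<omega> = k"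
    using \<omega> by (simp add: draws_pmf_def set_replicate_pmf)
  ultimately show ?thesis
    using lmo k unfolding lmo_rule_def by (metis append_eq_conv_conj order_refl sarah_fw_append)
qed

lemma iterate_mem:
  assumes lmo: "lmo_rule d X n fs b p \<eta> x0 K sel" and x0: "x0 \<in> X"
    and \<eta>: "\<And>k. 0 \<le> \<eta> k" "\<And>k. \<eta> k \<le> 1"
    and \<omega>: "\<omega> \<in> set_pmf (draws_pmf n b p K)"
  shows "k \<le> K \<Longrightarrow> fst (sarah_fw d n fs b \<eta> sel x0 \<omega> k) \<in> X"
proof (induction k)
  case 0
  then show ?case using x0 by simp
next
  case (Suc k)
  let ?x = "fst (sarah_fw d n fs b \<eta> sel x0 \<omega> k)" and ?s = "sel (take k \<omega>)"
  have "?x \<in> X" using Suc by simp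
  moreover have "?s \<in> X"
    using lmo \<omega> Suc.prems by (auto simp: lmo_rule_def is_arg_min_def)
  ultimately have "(\<lambda>j. (1 - \<eta> k) * ?x j + \<eta> k * ?s j) \<in> X"
    using convex_X \<eta>[of k] unfolding convex_Rd_def by auto
  also have "(\<lambda>j. (1 - \<eta> k) * ?x j + \<eta> k * ?s j) = fst (sarah_fw d n fs b \<eta> sel x0 \<omega> (Suc k))"
    by (auto simp: split_beta Let_def algebra_simps)
  finally show ?case .
qed

lemma iterate_mem_prefix:
  assumes lmo: "lmo_rule d X n fs b p \<eta> x0 K sel" and x0: "x0 \<in> X"
    and \<eta>: "\<And>k. 0 \<le> \<eta> k" "\<And>k. \<eta> k \<le> 1"
    and \<omega>: "\<omega> \<in> set_pmf (draws_pmf n b p k)" and k: "k \<le> K"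
  shows "fst (sarah_fw d n fs b \<eta> sel x0 \<omega> k) \<in> X"
proof -
  obtain \<omega>' where "\<omega> @ \<omega>' \<in> set_pmf (draws_pmf n b p K)"
    using set_draws_extend[OF \<omega> k] .
  from iterate_mem[OF lmo x0 \<eta> this k] show ?thesis
    using \<omega> by (simp add: sarah_fw_append draws_pmf_def set_replicate_pmf)
qed

text \<open>
  The last draw is independent of the run before it, so \<open>potential_step\<close> can be averaged over that
  run.
\<close>

lemma expected_potential_recursion:
  assumes lmo: "lmo_rule d X n fs b p \<eta> x0 K sel" and x0: "x0 \<in> X"
    and p: "0 < p" "p \<le> 1" and b: "b \<ge> 1"
    and \<eta>: "\<And>k. 0 \<le> \<eta> k" "\<And>k. \<eta> k \<le> p / 2" and k: "k < K"
  defines "A \<equiv> effective_smoothness b p"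
  defines "\<alpha> \<equiv> 1 / (p * A)"
  defines "\<Phi> \<equiv> \<lambda>k. measure_pmf.expectation (draws_pmf n b p k)
      (\<lambda>\<omega>. potential \<alpha> (sarah_fw d n fs b \<eta> sel x0 \<omega> k))"
  shows "\<Phi> (Suc k) \<le> (1 - \<eta> k) * \<Phi> k + (\<eta> k)\<^sup>2 * (3 / 2 * A * D\<^sup>2)"
proof -
  let ?S = "sarah_fw d n fs b \<eta> sel x0"
  let ?G = "3 / 2 * A * D\<^sup>2"
  have \<eta>1: "\<eta> j \<le> 1" for j using \<eta>(2)[of j] p by simp
  have step: "measure_pmf.expectation (draw_pmf n b p) (\<lambda>a. potential \<alpha> (?S (\<omega> @ [a]) (Suc k)))
      \<le> (1 - \<eta> k) * potential \<alpha> (?S \<omega> k) + (\<eta> k)\<^sup>2 * ?G"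
    if \<omega>: "\<omega> \<in> set_pmf (draws_pmf n b p k)" for \<omega>
  proof -
    obtain x g where xg: "?S \<omega> k = (x, g)" by fastforce
    let ?x' = "\<lambda>j. x j + \<eta> k * (sel \<omega> j - x j)"
    have len: "length \<omega> = k"
      using \<omega> by (simp add: draws_pmf_def set_replicate_pmf)
    note next_eq = sarah_fw_snoc[OF len xg]
    obtain a where "a \<in> set_pmf (draw_pmf n b p)"
      using set_pmf_not_empty by fast
    then have "\<omega> @ [a] \<in> set_pmf (draws_pmf n b p (Suc k))"
      using \<omega> unfolding draws_pmf_def set_replicate_pmf by auto
    from iterate_mem_prefix[OF lmo x0 \<eta>(1) \<eta>1 this] k next_eq[of a]
    have x': "?x' \<in> X" by (simp del: sarah_fw.simps)
    have x: "x \<in> X"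
      using iterate_mem_prefix[OF lmo x0 \<eta>(1) \<eta>1 \<omega>] k xg by simp
    have s: "is_arg_min (inner_Rd d g) (\<lambda>s. s \<in> X) (sel \<omega>)"
      using lmo_rule_prefix[OF lmo \<omega> k] xg by simp
    show ?thesis
      unfolding next_eq xg using potential_step[OF x \<eta>(1) \<eta>(2) s x' p b]
      by (simp add: \<alpha>_def A_def)
  qed
  have "\<Phi> (Suc k) \<le> measure_pmf.expectation (draws_pmf n b p k)
      (\<lambda>\<omega>. (1 - \<eta> k) * potential \<alpha> (?S \<omega> k) + (\<eta> k)\<^sup>2 * ?G)"
    unfolding \<Phi>_def expectation_draws_Suc
    by (intro expectation_mono_finite finite_set_draws step)
  also have "\<dots> = (1 - \<eta> k) * \<Phi> k + (\<eta> k)\<^sup>2 * ?G"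
    by (simp add: \<Phi>_def integrable_measure_pmf_finite[OF finite_set_draws])
  finally show ?thesis .
qed

lemma convergence_rate:
  assumes lmo: "lmo_rule d X n fs b p (fw_step p K) x0 K sel" and x0: "x0 \<in> X"
    and p: "0 < p" "p \<le> 1" and b: "b \<ge> 1" and K: "K \<ge> 1"
  shows "measure_pmf.expectation (draws_pmf n b p K)
      (\<lambda>\<omega>. f (fst (sarah_fw d n fs b (fw_step p K) sel x0 \<omega> K)) - f xstar)
    \<le> 18 * ((f x0 - f xstar) / p * exp (- (real K * p / 4)) + effective_smoothness b p * D\<^sup>2 / real K)"
proof -
  let ?S = "sarah_fw d n fs b (fw_step p K) sel x0"
  define A where "A = effective_smoothness b p"
  define \<alpha> where "\<alpha> = 1 / (p * A)"
  define \<Phi> where "\<Phi> k = measure_pmf.expectation (draws_pmf n b p k) (\<lambda>\<omega>. potential \<alpha> (?S \<omega> k))" for k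
  have A: "0 < A"
    using L_pos p unfolding A_def effective_smoothness_def
    by (intro add_pos_nonneg mult_nonneg_nonneg) (auto simp: sum_nonneg)
  have \<alpha>: "0 < \<alpha>" using A p by (simp add: \<alpha>_def)
  note \<eta> = fw_step_bounds[OF p]
  have \<eta>1: "fw_step p K k \<le> 1" for k
    using \<eta>(2)[of K k] p by simp
  have gap_le: "f x - f xstar \<le> potential \<alpha> (x, g)" for x g
    using \<alpha> by (simp add: potential_def)
  have nonneg: "0 \<le> \<Phi> k" if "k \<le> K" for k
    unfolding \<Phi>_def
  proof (intro integral_nonneg_AE, unfold AE_measure_pmf_iff, intro ballI)
    fix \<omega> assume "\<omega> \<in> set_pmf (draws_pmf n b p k)"
    from iterate_mem_prefix[OF lmo x0 \<eta>(1) \<eta>1 this that]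
    have "f xstar \<le> f (fst (?S \<omega> k))" by (rule f_xstar_le)
    then show "0 \<le> potential \<alpha> (?S \<omega> k)"
      using gap_le[of "fst (?S \<omega> k)" "snd (?S \<omega> k)"] by simp
  qed
  have G: "0 \<le> 3 / 2 * A * D\<^sup>2" using A by simp
  have start: "\<Phi> 0 = f x0 - f xstar"
    by (simp add: \<Phi>_def draws_pmf_def potential_def norm_Rd_power2)
  have "measure_pmf.expectation (draws_pmf n b p K) (\<lambda>\<omega>. f (fst (?S \<omega> K)) - f xstar) \<le> \<Phi> K"
    unfolding \<Phi>_def using gap_le
    by (intro expectation_mono_finite finite_set_draws) (metis prod.collapse)
  also have "\<dots> \<le> 12 * (\<Phi> 0 / p * exp (- (real K * p / 4)) + 3 / 2 * A * D\<^sup>2 / real K)"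
  proof (rule fw_step_recursion[OF p K G nonneg])
    fix k assume "k < K"
    from expected_potential_recursion[OF lmo x0 p b \<eta> this]
    show "\<Phi> (Suc k) \<le> (1 - fw_step p K k) * \<Phi> k + (fw_step p K k)\<^sup>2 * (3 / 2 * A * D\<^sup>2)"
      unfolding \<Phi>_def \<alpha>_def A_def .
  qed
  \<comment> \<open>\<open>18\<close> is the factor \<open>12\<close> of the scalar recursion times the \<open>3 / 2\<close> in its error term.\<close>
  also have "\<dots> \<le> 18 * ((f x0 - f xstar) / p * exp (- (real K * p / 4)) + A * D\<^sup>2 / real K)"
  proof -
    have "12 * (z + 3 / 2 * A * D\<^sup>2 / real K) \<le> 18 * (z + A * D\<^sup>2 / real K)" if "0 \<le> z" for z
      using that by (simp add: distrib_left)
    moreover have "0 \<le> (f x0 - f xstar) / p * exp (- (real K * p / 4))"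
      using f_xstar_le[OF x0] p by simp
    ultimately show ?thesis unfolding start by blast
  qed
  finally show ?thesis by (simp add: A_def)
qed

end

theorem theorem4p1:
  shows "\<exists>C::real. C > 0 \<and>
    (\<forall>(d::nat) (n::nat) (b::nat) (K::nat) (p::real) (L::real) (Li :: nat \<Rightarrow> real) (D::real)
       (X :: rvec set) (fs :: nat \<Rightarrow> rvec \<Rightarrow> real) (x0::rvec) (xstar::rvec)
       (sel :: draw list \<Rightarrow> rvec).
       let f = avg_fun n fs;
           Ltilde = sqrt ((\<Sum>i=1..n. (Li i)\<^sup>2) / real n);
           \<eta> = fw_step p K
       in
       d \<ge> 1 \<and> 1 \<le> b \<and> b \<le> n \<and> K \<ge> 1 \<and> 0 < p \<and> p \<le> 1 \<and>
       L > 0 \<and> D > 0 \<and> (\<forall>i\<in>{1..n}. Li i > 0) \<and>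
       X \<noteq> {} \<and> convex_Rd X \<and> compactin (Euclidean_space d) X \<and>
       (\<forall>x\<in>X. \<forall>y\<in>X. norm_Rd d (\<lambda>j. x j - y j) \<le> D) \<and>
       (\<forall>i\<in>{1..n}. differentiable_near d (fs i) X) \<and>
       smooth_on_Rd d L f X \<and>
       (\<forall>i\<in>{1..n}. smooth_on_Rd d (Li i) (fs i) X) \<and>
       grad_convex_on d f X \<and>
       is_arg_min f (\<lambda>x. x \<in> X) xstar \<and>
       x0 \<in> X \<and>
       lmo_rule d X n fs b p \<eta> x0 K sel
       \<longrightarrow>
       measure_pmf.expectation (draws_pmf n b p K)
         (\<lambda>\<omega>. f (fst (sarah_fw d n fs b \<eta> sel x0 \<omega> K)) - f xstar)
       \<le> C * ((f x0 - f xstar) / p * exp (- (real K * p / 4))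
              + (1 + Ltilde / L * sqrt ((1 - p) / (p * real b))) * (L * D\<^sup>2 / real K)))"
proof (intro exI[of _ "18::real"] conjI allI)
  show "(0::real) < 18" by simp
  fix d n b K :: nat and p L :: real and Li :: "nat \<Rightarrow> real" and D :: real and X :: "rvec set"
    and fs :: "nat \<Rightarrow> rvec \<Rightarrow> real" and x0 xstar :: rvec and sel :: "draw list \<Rightarrow> rvec"
  have rate: "measure_pmf.expectation (draws_pmf n b p K)
      (\<lambda>\<omega>. avg_fun n fs (fst (sarah_fw d n fs b (fw_step p K) sel x0 \<omega> K)) - avg_fun n fs xstar)
    \<le> 18 * ((avg_fun n fs x0 - avg_fun n fs xstar) / p * exp (- (real K * p / 4))
        + (1 + sqrt ((\<Sum>i=1..n. (Li i)\<^sup>2) / real n) / L * sqrt ((1 - p) / (p * real b)))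
          * (L * D\<^sup>2 / real K))"
    if asm: "1 \<le> b" "b \<le> n" "K \<ge> 1" "0 < p" "p \<le> 1" "L > 0" "convex_Rd X"
      "compactin (Euclidean_space d) X"
      "\<forall>x\<in>X. \<forall>y\<in>X. norm_Rd d (\<lambda>j. x j - y j) \<le> D"
      "\<forall>i\<in>{1..n}. differentiable_near d (fs i) X"
      "smooth_on_Rd d L (avg_fun n fs) X"
      "\<forall>i\<in>{1..n}. smooth_on_Rd d (Li i) (fs i) X"
      "grad_convex_on d (avg_fun n fs) X"
      "is_arg_min (avg_fun n fs) (\<lambda>x. x \<in> X) xstar"
      "x0 \<in> X" "lmo_rule d X n fs b p (fw_step p K) x0 K sel"
  proof -
    interpret finite_sum_problem d n L D Li X fs xstar
      using asm compactin_subset_topspace[OF asm(8)] by unfold_locales auto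
    have "effective_smoothness b p * D\<^sup>2 / real K
        = (1 + sqrt ((\<Sum>i=1..n. (Li i)\<^sup>2) / real n) / L * sqrt ((1 - p) / (p * real b)))
          * (L * D\<^sup>2 / real K)"
      using L_pos by (simp add: effective_smoothness_def add_divide_distrib distrib_right)
    then show ?thesis
      using convergence_rate[OF asm(16,15,4,5,1,3)] by (simp only:)
  qed
  show "let f = avg_fun n fs;
           Ltilde = sqrt ((\<Sum>i=1..n. (Li i)\<^sup>2) / real n);
           \<eta> = fw_step p K
       in
       d \<ge> 1 \<and> 1 \<le> b \<and> b \<le> n \<and> K \<ge> 1 \<and> 0 < p \<and> p \<le> 1 \<and>
       L > 0 \<and> D > 0 \<and> (\<forall>i\<in>{1..n}. Li i > 0) \<and>
       X \<noteq> {} \<and> convex_Rd X \<and> compactin (Euclidean_space d) X \<and>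
       (\<forall>x\<in>X. \<forall>y\<in>X. norm_Rd d (\<lambda>j. x j - y j) \<le> D) \<and>
       (\<forall>i\<in>{1..n}. differentiable_near d (fs i) X) \<and>
       smooth_on_Rd d L f X \<and>
       (\<forall>i\<in>{1..n}. smooth_on_Rd d (Li i) (fs i) X) \<and>
       grad_convex_on d f X \<and>
       is_arg_min f (\<lambda>x. x \<in> X) xstar \<and>
       x0 \<in> X \<and>
       lmo_rule d X n fs b p \<eta> x0 K sel
       \<longrightarrow>
       measure_pmf.expectation (draws_pmf n b p K)
         (\<lambda>\<omega>. f (fst (sarah_fw d n fs b \<eta> sel x0 \<omega> K)) - f xstar)
       \<le> 18 * ((f x0 - f xstar) / p * exp (- (real K * p / 4))
              + (1 + Ltilde / L * sqrt ((1 - p) / (p * real b))) * (L * D\<^sup>2 / real K))"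
    unfolding Let_def by (intro impI rate) (elim conjE, assumption)+
qed

end
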